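(* Let $m\ge 2$. For all $n\ge 1$ and all $k\ge 0$, $$|\{\pi\in\mathcal{S}_n:{\sf a}_m(\pi)=k\}|=|\{\pi\in\mathcal{S}_n:{\sf b}_m(\pi)=k\}|.$$
   Context: For $\tau\in\mathcal{S}_m$, an occurrence of $\tau$ in $\pi\in\mathcal{S}_n$ is a sequence $1\le i_1<\dots<i_m\le n$ such that $\pi_{i_1}\cdots\pi_{i_m}$ is order-isomorphic to $\tau$. Let $A_m=\{\tau\in\mathcal{S}_m:\tau_{m-1}=m,\ \tau_m=m-1\}$ and $B_m=\{\tau\in\mathcal{S}_m:\tau_{m-1}=m-1,\ \tau_m=m\}$. ${\sf a}_m(\pi)$ (resp. ${\sf b}_m(\pi)$) is the number of distinct pairs $(i,j)$, $1\le i<j\le n$, such that $i,j$ are the final two terms of some occurrence in $\pi$ of some pattern belonging to $A_m$ (resp. $B_m$). *)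

theory Defs
  imports "HOL-Combinatorics.Permutations"
begin

text \<open>
  The symmetric group on \<open>{1..n}\<close> is \<open>{\<pi>. \<pi> permutes {1..n}}\<close>, so the one-line
  notation of \<open>\<pi>\<close> is \<open>\<pi> 1, \<dots>, \<pi> n\<close>.  An index sequence of length \<open>m\<close> is a function
  on \<open>nat\<close> of which only the values on \<open>{1..m}\<close> matter.
\<close>

definition order_isomorphic :: "nat \<Rightarrow> (nat \<Rightarrow> nat) \<Rightarrow> (nat \<Rightarrow> nat) \<Rightarrow> bool" where
  "order_isomorphic m u v \<longleftrightarrow>
     (\<forall>s\<in>{1..m}. \<forall>t\<in>{1..m}. u s < u t \<longleftrightarrow> v s < v t)"

definition occurrence ::
  "nat \<Rightarrow> (nat \<Rightarrow> nat) \<Rightarrow> nat \<Rightarrow> (nat \<Rightarrow> nat) \<Rightarrow> (nat \<Rightarrow> nat) \<Rightarrow> bool" where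
  "occurrence m \<tau> n \<pi> ix \<longleftrightarrow>
     strict_mono_on {1..m} ix \<and> ix ` {1..m} \<subseteq> {1..n} \<and> order_isomorphic m (\<pi> \<circ> ix) \<tau>"

definition patterns_A :: "nat \<Rightarrow> (nat \<Rightarrow> nat) set" where
  "patterns_A m = {\<tau>. \<tau> permutes {1..m} \<and> \<tau> (m - 1) = m \<and> \<tau> m = m - 1}"

definition patterns_B :: "nat \<Rightarrow> (nat \<Rightarrow> nat) set" where
  "patterns_B m = {\<tau>. \<tau> permutes {1..m} \<and> \<tau> (m - 1) = m - 1 \<and> \<tau> m = m}"

definition final_pairs ::
  "nat \<Rightarrow> (nat \<Rightarrow> nat) set \<Rightarrow> nat \<Rightarrow> (nat \<Rightarrow> nat) \<Rightarrow> (nat \<times> nat) set" where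
  "final_pairs m T n \<pi> =
     {(i, j). 1 \<le> i \<and> i < j \<and> j \<le> n \<and>
        (\<exists>\<tau>\<in>T. \<exists>ix. occurrence m \<tau> n \<pi> ix \<and> ix (m - 1) = i \<and> ix m = j)}"

definition stat_a :: "nat \<Rightarrow> nat \<Rightarrow> (nat \<Rightarrow> nat) \<Rightarrow> nat" where
  "stat_a m n \<pi> = card (final_pairs m (patterns_A m) n \<pi>)"

definition stat_b :: "nat \<Rightarrow> nat \<Rightarrow> (nat \<Rightarrow> nat) \<Rightarrow> nat" where
  "stat_b m n \<pi> = card (final_pairs m (patterns_B m) n \<pi>)"

end

theory Submission imports Defs "HOL-Combinatorics.Multiset_Permutations" begin

text \<open>
  A pair \<open>i < j\<close> is counted by the statistic for \<open>A\<^sub>m\<close> iff \<open>\<pi> j < \<pi> i\<close> and at least \<open>m - 2\<close> of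
  the values before position \<open>i\<close> lie below \<open>\<pi> j\<close>; for \<open>B\<^sub>m\<close> the condition is \<open>\<pi> i < \<pi> j\<close> and at
  least \<open>m - 2\<close> of the values before position \<open>i\<close> lie below \<open>\<pi> i\<close>.

  Build \<open>\<pi>\<close> from left to right.  Call a value dominant if at least \<open>m - 2\<close> of the values used so
  far are smaller.  If \<open>d\<close> dominant values are still available, choosing the \<open>t\<close>-th smallest of
  them adds \<open>t - 1\<close> pairs to the first statistic and \<open>d - t\<close> to the second, and choosing a
  non-dominant value adds none to either.  A dominant choice does not change which values are
  dominant, so the number of continuations with a prescribed total depends only on the number of
  used values and on the used non-dominant ones, and the two statistics are equidistributed.
\<close>

section \<open>Weights of words\<close>

definition dominant :: "nat \<Rightarrow> 'a::linorder set \<Rightarrow> 'a \<Rightarrow> bool" where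
  "dominant p V y \<longleftrightarrow> p \<le> card {v\<in>V. v < y}"

definition descent_weight :: "nat \<Rightarrow> 'a::linorder set \<Rightarrow> 'a set \<Rightarrow> 'a \<Rightarrow> nat" where
  "descent_weight p N V y = card {z\<in>N - V. z < y \<and> dominant p V z}"

definition ascent_weight :: "nat \<Rightarrow> 'a::linorder set \<Rightarrow> 'a set \<Rightarrow> 'a \<Rightarrow> nat" where
  "ascent_weight p N V y = card {z\<in>N - V. y < z \<and> dominant p V y}"

text \<open>The letters already read enter only as a set, so their order has no influence on later
  weights.\<close>

fun word_weight :: "('a set \<Rightarrow> 'a \<Rightarrow> nat) \<Rightarrow> 'a set \<Rightarrow> 'a list \<Rightarrow> nat" where
  "word_weight w V [] = 0"
| "word_weight w V (x # xs) = w V x + word_weight w (insert x V) xs"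

text \<open>Used dominant values are recorded only by their number. This makes any two dominant
  choices equivalent, while enough is kept to determine the distribution of the weights still to
  come.\<close>

definition same_state :: "nat \<Rightarrow> 'a::linorder set \<Rightarrow> 'a set \<Rightarrow> bool" where
  "same_state p V V' \<longleftrightarrow> card V = card V' \<and> (\<forall>y. dominant p V y \<longleftrightarrow> dominant p V' y) \<and>
     {v\<in>V. \<not> dominant p V v} = {v\<in>V'. \<not> dominant p V' v}"

section \<open>Dominance and states when a value is added\<close>

lemma dominant_mono:
  assumes "finite V" "dominant p V y" "y \<le> z"
  shows "dominant p V z"
proof -
  have "card {v\<in>V. v < y} \<le> card {v\<in>V. v < z}"
    using assms by (intro card_mono) auto
  then show ?thesis using assms by (simp add: dominant_def)
qed

lemma dominant_insert:
  assumes "finite V" "dominant p V z"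
  shows "dominant p (insert y V) z"
proof -
  have "card {v\<in>V. v < z} \<le> card {v\<in>insert y V. v < z}"
    using assms by (intro card_mono) auto
  then show ?thesis using assms by (simp add: dominant_def)
qed

text \<open>Adding \<open>y\<close> changes only the counts for values above \<open>y\<close>, and
  these values are dominant both before and after, by monotonicity.\<close>

lemma dominant_insert_dominant:
  assumes "finite V" "dominant p V y"
  shows "dominant p (insert y V) z \<longleftrightarrow> dominant p V z"
proof (cases "y < z")
  case True
  then show ?thesis using assms dominant_mono[of V p y z] dominant_insert[of V p z y] by auto
next
  case False
  then have "{v\<in>insert y V. v < z} = {v\<in>V. v < z}" by auto
  then show ?thesis by (simp add: dominant_def)
qed

text \<open>Dominance is unchanged on both sides and the new values are dominant, so the used
  non-dominant values stay the same even if \<open>y\<close> and \<open>y'\<close> differ.\<close>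

lemma same_state_insert_dominant:
  assumes "finite V" "finite V'" "same_state p V V'"
    and "y \<notin> V" "y' \<notin> V'" "dominant p V y" "dominant p V' y'"
  shows "same_state p (insert y V) (insert y' V')"
  using assms unfolding same_state_def
  by (auto simp: dominant_insert_dominant)

lemma same_state_insert:
  assumes "finite V" "finite V'" and same: "same_state p V V'"
    and "y \<notin> V" "y \<notin> V'"
  shows "same_state p (insert y V) (insert y V')"
proof -
  have dom: "dominant p V z \<longleftrightarrow> dominant p V' z" for z
    using same by (simp add: same_state_def)
  have low: "v \<in> V \<longleftrightarrow> v \<in> V'" if "\<not> dominant p V v" for v
    using same that by (auto simp: same_state_def)
  have dom': "dominant p (insert y V) z \<longleftrightarrow> dominant p (insert y V') z" for z
  proof (cases "dominant p V z")
    case True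
    then show ?thesis using assms dom by (auto intro: dominant_insert)
  next
    case False
    \<comment> \<open>Everything below a non-dominant \<open>z\<close> is non-dominant, so
      \<open>V\<close> and \<open>V'\<close> agree below \<open>z\<close>.\<close>
    then have "v \<in> V \<longleftrightarrow> v \<in> V'" if "v < z" for v
      using low dominant_mono[OF \<open>finite V\<close>, of p v z] that by fastforce
    then have "{v\<in>insert y V. v < z} = {v\<in>insert y V'. v < z}" by auto
    then show ?thesis by (simp add: dominant_def)
  qed
  have "v \<in> V \<longleftrightarrow> v \<in> V'" if "\<not> dominant p (insert y V) v" for v
    using low that dominant_insert[OF \<open>finite V\<close>] by blast
  then have "{v\<in>insert y V. \<not> dominant p (insert y V) v}
      = {v\<in>insert y V'. \<not> dominant p (insert y V') v}"
    using dom' by auto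
  moreover have "card (insert y V) = card (insert y V')"
    using assms by (simp add: same_state_def)
  ultimately show ?thesis using dom' by (simp add: same_state_def)
qed

section \<open>Sums over ranks and over first letters\<close>

lemma sum_rank_below:
  fixes D :: "'a::linorder set"
  assumes "finite D"
  shows "(\<Sum>y\<in>D. h (card {z\<in>D. z < y})) = (\<Sum>t<card D. h t :: nat)"
  using assms
proof (induction D rule: finite_linorder_max_induct)
  case empty
  then show ?case by simp
next
  case (insert b D)
  have "b \<notin> D" using insert by auto
  \<comment> \<open>A new maximum gets rank \<open>card D\<close> and leaves all other ranks
    unchanged.\<close>
  have "{z\<in>insert b D. z < b} = D" using insert by auto
  moreover have "{z\<in>insert b D. z < y} = {z\<in>D. z < y}" if "y \<in> D" for y
    using insert that by force
  ultimately show ?case using insert \<open>b \<notin> D\<close> by simp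
qed

lemma sum_rank_above:
  fixes D :: "'a::linorder set"
  assumes "finite D"
  shows "(\<Sum>y\<in>D. h (card {z\<in>D. y < z})) = (\<Sum>t<card D. h t :: nat)"
  using assms
proof (induction D rule: finite_linorder_min_induct)
  case empty
  then show ?case by simp
next
  case (insert b D)
  have "b \<notin> D" using insert by auto
  have "{z\<in>insert b D. b < z} = D" using insert by auto
  moreover have "{z\<in>insert b D. y < z} = {z\<in>D. y < z}" if "y \<in> D" for y
    using insert that by force
  ultimately show ?case using insert \<open>b \<notin> D\<close> by simp
qed

lemma sum_permutations_of_set_Cons:
  assumes "finite U" "U \<noteq> {}"
  shows "(\<Sum>xs\<in>permutations_of_set U. g xs)
    = (\<Sum>y\<in>U. \<Sum>xs\<in>permutations_of_set (U - {y}). g (y # xs))"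
proof -
  have "(\<Sum>xs\<in>permutations_of_set U. g xs)
    = (\<Sum>y\<in>U. sum g ((#) y ` permutations_of_set (U - {y})))"
    unfolding permutations_of_set_nonempty[OF assms(2)]
    using assms by (intro sum.UNION_disjoint) auto
  also have "\<dots> = (\<Sum>y\<in>U. \<Sum>xs\<in>permutations_of_set (U - {y}). g (y # xs))"
    by (simp add: sum.reindex)
  finally show ?thesis .
qed

text \<open>Quantifying over all \<open>f\<close> expresses that the two weights have the same distribution.\<close>

lemma sum_descent_weight_eq_sum_ascent_weight:
  fixes N :: "'a::linorder set" and f :: "nat \<Rightarrow> nat"
  assumes "finite N" "V \<subseteq> N" "V' \<subseteq> N" "same_state p V V'"
  shows "(\<Sum>xs\<in>permutations_of_set (N - V). f (word_weight (descent_weight p N) V xs))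
       = (\<Sum>xs\<in>permutations_of_set (N - V'). f (word_weight (ascent_weight p N) V' xs))"
  using assms
\<comment> \<open>\<open>f\<close> is generalized because a first letter of weight \<open>t\<close>
  replaces it by \<open>\<lambda>s. f (t + s)\<close> on the rest of the word.\<close>
proof (induction "card (N - V)" arbitrary: V V' f)
  case 0
  then have "V = N" by auto
  moreover from this have "V' = N"
    using 0 by (auto simp: same_state_def card_subset_eq)
  ultimately show ?case by simp
next
  case (Suc c)
  note fin = \<open>finite N\<close>
  have finV: "finite V" "finite V'" using Suc.prems finite_subset by auto
  have card: "card V = card V'" using Suc.prems by (simp add: same_state_def)
  have dom: "dominant p V z \<longleftrightarrow> dominant p V' z" for z
    using Suc.prems by (simp add: same_state_def)
  have low: "v \<in> V \<longleftrightarrow> v \<in> V'" if "\<not> dominant p V v" for v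
    using Suc.prems that by (auto simp: same_state_def)
  \<comment> \<open>The weight \<open>t\<close> of the first letter is kept apart from the letter
    \<open>y\<close>, so that weights can be redistributed among the dominant letters.\<close>
  define SA where "SA y t = (\<Sum>xs\<in>permutations_of_set (N - insert y V).
      f (t + word_weight (descent_weight p N) (insert y V) xs))" for y t
  define SB where "SB y t = (\<Sum>xs\<in>permutations_of_set (N - insert y V').
      f (t + word_weight (ascent_weight p N) (insert y V') xs))" for y t
  have IH: "SA y t = SB y' t"
    if "y \<in> N - V" "y' \<in> N - V'" "same_state p (insert y V) (insert y' V')" for y y' t
  proof -
    have "N - insert y V = (N - V) - {y}" by auto
    then have "c = card (N - insert y V)"
      using Suc.hyps(2) that fin by simp
    then show ?thesis unfolding SA_def SB_def
      using Suc.hyps(1)[of "insert y V" "insert y' V'" "\<lambda>s. f (t + s)"] that Suc.prems by auto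
  qed
  define D where "D = {y\<in>N - V. dominant p V y}"
  define D' where "D' = {y\<in>N - V'. dominant p V' y}"
  define L where "L = {y\<in>N - V. \<not> dominant p V y}"
  have L': "L = {y\<in>N - V'. \<not> dominant p V' y}"
    using low dom by (auto simp: L_def)
  have finDL: "finite D" "finite D'" "finite L" using fin by (auto simp: D_def D'_def L_def)
  have split: "N - V = L \<union> D" "L \<inter> D = {}" "N - V' = L \<union> D'" "L \<inter> D' = {}"
    using L' by (auto simp: L_def D_def D'_def)
  have "card (N - V) = card (N - V')"
    using card Suc.prems finV by (simp add: card_Diff_subset)
  then have cardD: "card D = card D'"
    unfolding split(1,3) using split finDL by (simp add: card_Un_disjoint)
  have ne: "N - V \<noteq> {}" "N - V' \<noteq> {}"
    using Suc.hyps(2) \<open>card (N - V) = card (N - V')\<close> by force+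
  have wL: "descent_weight p N V y = 0" "ascent_weight p N V' y = 0" if "y \<in> L" for y
  proof -
    have "{z\<in>N - V. z < y \<and> dominant p V z} = {}"
      using that dominant_mono[OF finV(1)] by (force simp: L_def)
    then show "descent_weight p N V y = 0" by (simp only: descent_weight_def card.empty)
    show "ascent_weight p N V' y = 0" using that by (simp add: ascent_weight_def L')
  qed
  have wD: "descent_weight p N V y = card {z\<in>D. z < y}" for y
    unfolding descent_weight_def D_def by (rule arg_cong[where f = card]) auto
  have wD': "ascent_weight p N V' y = card {z\<in>D'. y < z}" if "y \<in> D'" for y
    unfolding ascent_weight_def D'_def using that dominant_mono[OF finV(2), of p y]
    by (intro arg_cong[where f = card]) (auto simp: D'_def)
  have "(\<Sum>y\<in>D. SA y (card {z\<in>D. z < y})) = (\<Sum>y\<in>D'. SB y (card {z\<in>D'. y < z}))"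
  proof (cases "D = {}")
    case True
    then show ?thesis using cardD finDL by simp
  next
    case False
    then obtain y0 y0' where y0: "y0 \<in> D" "y0' \<in> D'" using cardD finDL by fastforce
    \<comment> \<open>All dominant choices on either side lead to the same state, so a fixed
      \<open>y0'\<close> can stand for each of them.\<close>
    have AB: "SA y t = SB y' t" if "y \<in> D" "y' \<in> D'" for y y' t
      using that Suc.prems finV same_state_insert_dominant[of V V' p y y']
      by (intro IH) (auto simp: D_def D'_def)
    have "(\<Sum>y\<in>D. SA y (card {z\<in>D. z < y})) = (\<Sum>y\<in>D. SB y0' (card {z\<in>D. z < y}))"
      using AB y0 by (intro sum.cong) auto
    \<comment> \<open>Ranks from below in \<open>D\<close> and ranks from above in \<open>D'\<close>
      both run once through 0, ..., \<open>card D\<close> - 1.\<close>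
    also have "\<dots> = (\<Sum>y\<in>D'. SB y0' (card {z\<in>D'. y < z}))"
      using finDL cardD by (simp only: sum_rank_below sum_rank_above)
    also have "\<dots> = (\<Sum>y\<in>D'. SB y (card {z\<in>D'. y < z}))"
      using AB y0 by (intro sum.cong refl) metis
    finally show ?thesis .
  qed
  moreover have "(\<Sum>y\<in>L. SA y 0) = (\<Sum>y\<in>L. SB y 0)"
  proof (intro sum.cong refl IH)
    fix y assume "y \<in> L"
    then show yN: "y \<in> N - V" "y \<in> N - V'" using split by auto
    then show "same_state p (insert y V) (insert y V')"
      using finV Suc.prems by (intro same_state_insert) auto
  qed
  moreover have "(\<Sum>xs\<in>permutations_of_set (N - V). f (word_weight (descent_weight p N) V xs))
      = (\<Sum>y\<in>N - V. SA y (descent_weight p N V y))"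
    using fin ne by (simp add: sum_permutations_of_set_Cons SA_def Diff_insert[symmetric])
  moreover have "\<dots> = (\<Sum>y\<in>L. SA y 0) + (\<Sum>y\<in>D. SA y (card {z\<in>D. z < y}))"
    unfolding split(1) using finDL split(2) wL by (simp add: sum.union_disjoint wD[symmetric])
  moreover have "(\<Sum>xs\<in>permutations_of_set (N - V'). f (word_weight (ascent_weight p N) V' xs))
      = (\<Sum>y\<in>N - V'. SB y (ascent_weight p N V' y))"
    using fin ne by (simp add: sum_permutations_of_set_Cons SB_def Diff_insert[symmetric])
  moreover have "\<dots> = (\<Sum>y\<in>L. SB y 0) + (\<Sum>y\<in>D'. SB y (card {z\<in>D'. y < z}))"
    unfolding split(3) using finDL split(4) wL wD' by (simp add: sum.union_disjoint)
  ultimately show ?case by simp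
qed

section \<open>Occurrences with prescribed final two positions\<close>

text \<open>This is standardization: each entry is replaced by its rank. The rank formula is
  exported because the final two entries of the pattern are computed from it later.\<close>

lemma exists_order_isomorphic_permutation:
  assumes inj: "inj_on u {1..m}"
  obtains \<tau> where "\<tau> permutes {1..m}" "order_isomorphic m u \<tau>"
    "\<And>s. s \<in> {1..m} \<Longrightarrow> \<tau> s = card {t\<in>{1..m}. u t \<le> u s}"
proof -
  define \<tau> where "\<tau> s = (if s \<in> {1..m} then card {t\<in>{1..m}. u t \<le> u s} else s)" for s
  have val: "\<tau> s = card {t\<in>{1..m}. u t \<le> u s}" if "s \<in> {1..m}" for s
    using that by (simp add: \<tau>_def)
  have less: "\<tau> s < \<tau> t" if "s \<in> {1..m}" "t \<in> {1..m}" "u s < u t" for s t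
  proof -
    have "{r\<in>{1..m}. u r \<le> u s} \<subset> {r\<in>{1..m}. u r \<le> u t}"
    proof
      show "{r\<in>{1..m}. u r \<le> u s} \<subseteq> {r\<in>{1..m}. u r \<le> u t}" using that by auto
      have "t \<in> {r\<in>{1..m}. u r \<le> u t} - {r\<in>{1..m}. u r \<le> u s}" using that by auto
      then show "{r\<in>{1..m}. u r \<le> u s} \<noteq> {r\<in>{1..m}. u r \<le> u t}" by blast
    qed
    then show ?thesis using that by (simp add: val psubset_card_mono)
  qed
  have iso: "u s < u t \<longleftrightarrow> \<tau> s < \<tau> t" if "s \<in> {1..m}" "t \<in> {1..m}" for s t
    using that less[of s t] less[of t s] inj_onD[OF inj, of s t]
    by (metis less_asym less_irrefl linorder_neqE_nat)
  have "inj_on \<tau> {1..m}"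
    using iso inj by (intro inj_onI) (metis inj_onD less_irrefl linorder_neqE_nat)
  moreover have "\<tau> ` {1..m} \<subseteq> {1..m}"
  proof
    fix x assume "x \<in> \<tau> ` {1..m}"
    then obtain s where s: "s \<in> {1..m}" "x = \<tau> s" by auto
    have "card {t\<in>{1..m}. u t \<le> u s} \<le> card {1..m}" by (intro card_mono) auto
    moreover have "card {t\<in>{1..m}. u t \<le> u s} > 0" using s by (auto simp: card_gt_0_iff)
    ultimately show "x \<in> {1..m}" using s by (simp add: val)
  qed
  ultimately have "bij_betw \<tau> {1..m} {1..m}"
    by (simp add: bij_betw_def endo_inj_surj)
  then have "\<tau> permutes {1..m}"
    by (rule bij_imp_permutes) (auto simp: \<tau>_def)
  then show ?thesis using that iso val by (auto simp: order_isomorphic_def)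
qed

lemma exists_strict_mono_index:
  fixes S :: "nat set"
  assumes "S \<subseteq> {1..<i}" "p \<le> card S" "i < j"
  obtains ix where "strict_mono_on {1..p + 2} ix" "ix ` {1..p} \<subseteq> S"
    "ix (p + 1) = i" "ix (p + 2) = j"
proof -
  obtain T where T: "T \<subseteq> S" "card T = p" "finite T"
    using assms obtain_subset_with_card_n by metis
  define L where "L = sorted_list_of_set T @ [i, j]"
  \<comment> \<open>List positions start at 0, pattern positions at 1.\<close>
  define ix where "ix s = L ! (s - 1)" for s
  have len: "length (sorted_list_of_set T) = p" using T by simp
  have "sorted_wrt (<) L"
    using T assms by (force simp: L_def sorted_wrt_append)
  then have "strict_mono_on {1..p + 2} ix"
    unfolding ix_def by (intro strict_mono_onI sorted_wrt_nth_less[of "(<)"]) (auto simp: L_def len T)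
  moreover have "ix s \<in> S" if "s \<in> {1..p}" for s
  proof -
    have "sorted_list_of_set T ! (s - 1) \<in> set (sorted_list_of_set T)"
      using that len by (intro nth_mem) auto
    then show ?thesis using that T len by (auto simp: ix_def L_def nth_append)
  qed
  moreover have "ix (p + 1) = i" "ix (p + 2) = j"
    by (auto simp: ix_def L_def nth_append len T)
  ultimately show ?thesis using that by blast
qed

text \<open>The two largest entries of \<open>\<tau>\<close> are its final two, so the first
  \<open>p\<close> chosen positions carry values below both final ones. Treating the final entries
  as a set covers both pattern families.\<close>

lemma card_below_final_pair:
  assumes occ: "occurrence (p + 2) \<tau> n \<pi> ix" and \<tau>: "\<tau> permutes {1..p + 2}"
    and top: "\<tau> ` {p + 1, p + 2} = {p + 1, p + 2}" and r: "r \<in> {p + 1, p + 2}"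
  shows "p \<le> card {l\<in>{1..<ix (p + 1)}. \<pi> l < \<pi> (ix r)}"
proof -
  have mono: "strict_mono_on {1..p + 2} ix" and sub: "ix ` {1..p + 2} \<subseteq> {1..n}"
    and iso: "order_isomorphic (p + 2) (\<pi> \<circ> ix) \<tau>"
    using occ by (auto simp: occurrence_def)
  have "ix ` {1..p} \<subseteq> {l\<in>{1..<ix (p + 1)}. \<pi> l < \<pi> (ix r)}"
  proof clarify
    fix s assume s: "s \<in> {1..p}"
    have "\<tau> s \<notin> \<tau> ` {p + 1, p + 2}"
      using s by (auto simp: inj_eq[OF permutes_inj[OF \<tau>]])
    moreover have "\<tau> s \<in> {1..p + 2}" using s permutes_in_image[OF \<tau>, of s] by auto
    ultimately have "\<tau> s < p + 1" unfolding top by auto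
    moreover have "\<tau> r \<in> {p + 1, p + 2}" using r top by blast
    ultimately have "\<tau> s < \<tau> r" by auto
    then have "\<pi> (ix s) < \<pi> (ix r)"
      using iso s r by (auto simp: order_isomorphic_def)
    moreover have "ix s < ix (p + 1)" using s by (intro strict_mono_onD[OF mono]) auto
    moreover have "ix s \<in> {1..n}" using s sub by (intro subsetD[OF sub] imageI) auto
    ultimately show "ix s \<in> {1..<ix (p + 1)} \<and> \<pi> (ix s) < \<pi> (ix r)" by auto
  qed
  moreover have "card (ix ` {1..p}) = p"
    using strict_mono_on_imp_inj_on[OF mono] by (subst card_image) (auto intro: inj_on_subset)
  moreover have "finite {l\<in>{1..<ix (p + 1)}. \<pi> l < \<pi> (ix r)}" by simp
  ultimately show ?thesis by (metis card_mono)
qed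

text \<open>Any \<open>p\<close> earlier positions with values below both \<open>\<pi> i\<close> and
  \<open>\<pi> j\<close> complete the pair to an occurrence; the order of \<open>\<pi> i\<close> and
  \<open>\<pi> j\<close> then decides the pattern family.\<close>

lemma exists_occurrence_with_final_pair:
  assumes \<pi>: "\<pi> permutes {1..n}" and ij: "1 \<le> i" "i < j" "j \<le> n"
    and card: "p \<le> card {l\<in>{1..<i}. \<pi> l < min (\<pi> i) (\<pi> j)}"
  obtains \<tau> ix where "\<tau> permutes {1..p + 2}" "occurrence (p + 2) \<tau> n \<pi> ix"
    "ix (p + 1) = i" "ix (p + 2) = j"
    "\<tau> (p + 1) = (if \<pi> j < \<pi> i then p + 2 else p + 1)"
    "\<tau> (p + 2) = (if \<pi> j < \<pi> i then p + 1 else p + 2)"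
proof -
  obtain ix where mono: "strict_mono_on {1..p + 2} ix"
    and low: "ix ` {1..p} \<subseteq> {l\<in>{1..<i}. \<pi> l < min (\<pi> i) (\<pi> j)}"
    and last: "ix (p + 1) = i" "ix (p + 2) = j"
    by (rule exists_strict_mono_index[OF _ card ij(2)]) auto
  have index_cases: "s \<in> {1..p} \<or> s = p + 1 \<or> s = p + 2" if "s \<in> {1..p + 2}" for s
    using that by auto
  have inj: "inj_on (\<pi> \<circ> ix) {1..p + 2}"
    using strict_mono_on_imp_inj_on[OF mono] permutes_inj[OF \<pi>]
    by (auto intro!: comp_inj_on intro: inj_on_subset)
  obtain \<tau> where \<tau>: "\<tau> permutes {1..p + 2}" "order_isomorphic (p + 2) (\<pi> \<circ> ix) \<tau>"
    and val: "\<And>s. s \<in> {1..p + 2} \<Longrightarrow> \<tau> s = card {t\<in>{1..p + 2}. (\<pi> \<circ> ix) t \<le> (\<pi> \<circ> ix) s}"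
    using exists_order_isomorphic_permutation[OF inj] by blast
  have "ix s \<in> {1..n}" if "s \<in> {1..p + 2}" for s
    using index_cases[OF that] low last ij by force
  then have occ: "occurrence (p + 2) \<tau> n \<pi> ix"
    using mono \<tau> by (auto simp: occurrence_def)
  have lowD: "\<pi> (ix s) < \<pi> i" "\<pi> (ix s) < \<pi> j" if "s \<in> {1..p}" for s
    using low that by force+
  have "\<pi> i \<noteq> \<pi> j" using ij by (simp add: inj_eq[OF permutes_inj[OF \<pi>]])
  \<comment> \<open>Among the chosen entries only the other final one can exceed
    \<open>\<pi> i\<close> or \<open>\<pi> j\<close>, so their ranks are \<open>p + 1\<close> and
    \<open>p + 2\<close> in some order.\<close>
  then have le: "\<pi> (ix t) \<le> \<pi> i \<longleftrightarrow> t \<noteq> p + 2 \<or> \<pi> j < \<pi> i"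
    "\<pi> (ix t) \<le> \<pi> j \<longleftrightarrow> t \<noteq> p + 1 \<or> \<not> \<pi> j < \<pi> i" if "t \<in> {1..p + 2}" for t
    using index_cases[OF that] lowD[of t] last by auto
  have "\<tau> (p + 1) = card {t\<in>{1..p + 2}. \<pi> (ix t) \<le> \<pi> i}"
    "\<tau> (p + 2) = card {t\<in>{1..p + 2}. \<pi> (ix t) \<le> \<pi> j}"
    using val[of "p + 1"] val[of "p + 2"] last by auto
  moreover have "{t\<in>{1..p + 2}. \<pi> (ix t) \<le> \<pi> i} = (if \<pi> j < \<pi> i then {1..p + 2} else {1..p + 1})"
    by (auto simp: le)
  moreover have "{t\<in>{1..p + 2}. \<pi> (ix t) \<le> \<pi> j}
      = (if \<pi> j < \<pi> i then insert (p + 2) {1..p} else {1..p + 2})"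
    by (auto simp: le)
  ultimately show ?thesis using that[OF \<tau>(1) occ last] by auto
qed

text \<open>In a descent the smaller final value is \<open>\<pi> j\<close>, so that is the value to
  be bounded below. The \<open>SIGMA\<close> form turns the cardinality into a sum over
  \<open>i\<close>.\<close>

lemma final_pairs_patterns_A:
  assumes \<pi>: "\<pi> permutes {1..n}"
  shows "final_pairs (p + 2) (patterns_A (p + 2)) n \<pi> =
    (SIGMA i:{1..n}. {j\<in>{i<..n}. \<pi> j < \<pi> i \<and> p \<le> card {l\<in>{1..<i}. \<pi> l < \<pi> j}})"
proof (intro set_eqI iffI; clarify)
  fix i j assume "(i, j) \<in> final_pairs (p + 2) (patterns_A (p + 2)) n \<pi>"
  then obtain \<tau> ix where ij: "1 \<le> i" "i < j" "j \<le> n" and \<tau>: "\<tau> permutes {1..p + 2}"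
    "\<tau> (p + 1) = p + 2" "\<tau> (p + 2) = p + 1"
    and occ: "occurrence (p + 2) \<tau> n \<pi> ix" and ix: "ix (p + 1) = i" "ix (p + 2) = j"
    by (auto simp: final_pairs_def patterns_A_def)
  have "p \<le> card {l\<in>{1..<i}. \<pi> l < \<pi> j}"
    using card_below_final_pair[OF occ \<tau>(1), of "p + 2"] \<tau> ix by auto
  moreover have "order_isomorphic (p + 2) (\<pi> \<circ> ix) \<tau>" using occ by (simp add: occurrence_def)
  then have "(\<pi> \<circ> ix) (p + 2) < (\<pi> \<circ> ix) (p + 1) \<longleftrightarrow> \<tau> (p + 2) < \<tau> (p + 1)"
    unfolding order_isomorphic_def by (elim ballE) auto
  then have "\<pi> j < \<pi> i" using \<tau> ix by simp
  ultimately show "i \<in> {1..n} \<and>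
      j \<in> {j\<in>{i<..n}. \<pi> j < \<pi> i \<and> p \<le> card {l\<in>{1..<i}. \<pi> l < \<pi> j}}"
    using ij by auto
next
  fix i j assume ij: "i \<in> {1..n}" "j \<in> {i<..n}" "\<pi> j < \<pi> i"
    and card: "p \<le> card {l\<in>{1..<i}. \<pi> l < \<pi> j}"
  have "min (\<pi> i) (\<pi> j) = \<pi> j" using ij by simp
  then obtain \<tau> ix where "\<tau> permutes {1..p + 2}" "occurrence (p + 2) \<tau> n \<pi> ix"
    "ix (p + 1) = i" "ix (p + 2) = j" "\<tau> (p + 1) = p + 2" "\<tau> (p + 2) = p + 1"
    using exists_occurrence_with_final_pair[OF \<pi>, of i j p] ij card by auto
  then show "(i, j) \<in> final_pairs (p + 2) (patterns_A (p + 2)) n \<pi>"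
    using ij by (auto simp: final_pairs_def patterns_A_def)
qed

text \<open>In an ascent the smaller final value is \<open>\<pi> i\<close>, so the count of smaller
  earlier values depends on \<open>i\<close> alone.\<close>

lemma final_pairs_patterns_B:
  assumes \<pi>: "\<pi> permutes {1..n}"
  shows "final_pairs (p + 2) (patterns_B (p + 2)) n \<pi> =
    (SIGMA i:{1..n}. {j\<in>{i<..n}. \<pi> i < \<pi> j \<and> p \<le> card {l\<in>{1..<i}. \<pi> l < \<pi> i}})"
proof (intro set_eqI iffI; clarify)
  fix i j assume "(i, j) \<in> final_pairs (p + 2) (patterns_B (p + 2)) n \<pi>"
  then obtain \<tau> ix where ij: "1 \<le> i" "i < j" "j \<le> n" and \<tau>: "\<tau> permutes {1..p + 2}"
    "\<tau> (p + 1) = p + 1" "\<tau> (p + 2) = p + 2"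
    and occ: "occurrence (p + 2) \<tau> n \<pi> ix" and ix: "ix (p + 1) = i" "ix (p + 2) = j"
    by (auto simp: final_pairs_def patterns_B_def)
  have "p \<le> card {l\<in>{1..<i}. \<pi> l < \<pi> i}"
    using card_below_final_pair[OF occ \<tau>(1), of "p + 1"] \<tau> ix by auto
  moreover have "order_isomorphic (p + 2) (\<pi> \<circ> ix) \<tau>" using occ by (simp add: occurrence_def)
  then have "(\<pi> \<circ> ix) (p + 1) < (\<pi> \<circ> ix) (p + 2) \<longleftrightarrow> \<tau> (p + 1) < \<tau> (p + 2)"
    unfolding order_isomorphic_def by (elim ballE) auto
  then have "\<pi> i < \<pi> j" using \<tau> ix by simp
  ultimately show "i \<in> {1..n} \<and>
      j \<in> {j\<in>{i<..n}. \<pi> i < \<pi> j \<and> p \<le> card {l\<in>{1..<i}. \<pi> l < \<pi> i}}"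
    using ij by auto
next
  fix i j assume ij: "i \<in> {1..n}" "j \<in> {i<..n}" "\<pi> i < \<pi> j"
    and card: "p \<le> card {l\<in>{1..<i}. \<pi> l < \<pi> i}"
  have "min (\<pi> i) (\<pi> j) = \<pi> i" using ij by simp
  then obtain \<tau> ix where "\<tau> permutes {1..p + 2}" "occurrence (p + 2) \<tau> n \<pi> ix"
    "ix (p + 1) = i" "ix (p + 2) = j" "\<tau> (p + 1) = p + 1" "\<tau> (p + 2) = p + 2"
    using exists_occurrence_with_final_pair[OF \<pi>, of i j p] ij card by auto
  then show "(i, j) \<in> final_pairs (p + 2) (patterns_B (p + 2)) n \<pi>"
    using ij by (auto simp: final_pairs_def patterns_B_def)
qed

section \<open>The statistics as weights of one-line notations\<close>

text \<open>Starting after an arbitrary prefix of length \<open>a\<close> makes the induction on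
  \<open>d\<close> go through; the case \<open>a = 0\<close> is the one applied to the
  statistics.\<close>

lemma word_weight_map_upt:
  "word_weight w (\<pi> ` {1..<Suc a}) (map \<pi> [Suc a..<Suc (a + d)])
    = (\<Sum>i\<in>{Suc a..a + d}. w (\<pi> ` {1..<i}) (\<pi> i))"
proof (induction d arbitrary: a)
  case 0
  then show ?case by simp
next
  case (Suc d)
  have "[Suc a..<Suc (a + Suc d)] = Suc a # [Suc (Suc a)..<Suc (Suc a + d)]"
    by (simp add: upt_conv_Cons del: upt_Suc)
  moreover have "insert (\<pi> (Suc a)) (\<pi> ` {1..<Suc a}) = \<pi> ` {1..<Suc (Suc a)}"
    by (auto simp: atLeastLessThanSuc)
  moreover have "{Suc a..a + Suc d} = insert (Suc a) {Suc (Suc a)..Suc a + d}" by auto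
  ultimately show ?case using Suc[of "Suc a"] by (simp del: upt_Suc)
qed

lemma dominant_image:
  assumes "inj \<pi>"
  shows "dominant p (\<pi> ` I) z \<longleftrightarrow> p \<le> card {l\<in>I. \<pi> l < z}"
proof -
  have "{v\<in>\<pi> ` I. v < z} = \<pi> ` {l\<in>I. \<pi> l < z}" by auto
  then show ?thesis using assms by (simp add: dominant_def card_image inj_on_subset)
qed

lemma card_unused_values:
  fixes n :: nat
  assumes \<pi>: "\<pi> permutes {1..n}" and "1 \<le> i" and "\<not> P (\<pi> i)"
  shows "card {z\<in>{1..n} - \<pi> ` {1..<i}. P z} = card {j\<in>{i<..n}. P (\<pi> j)}"
proof -
  have inj: "inj \<pi>" using permutes_inj[OF \<pi>] .
  have "{z\<in>{1..n} - \<pi> ` {1..<i}. P z} = \<pi> ` {j\<in>{i<..n}. P (\<pi> j)}"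
  proof (intro set_eqI iffI)
    fix z assume z: "z \<in> {z\<in>{1..n} - \<pi> ` {1..<i}. P z}"
    then obtain j where j: "j \<in> {1..n}" "z = \<pi> j"
      using permutes_image[OF \<pi>] by (metis (no_types, lifting) DiffD1 imageE mem_Collect_eq)
    then have "j \<notin> {1..<i}" "j \<noteq> i" using z assms by auto
    then have "j \<in> {j\<in>{i<..n}. P (\<pi> j)}" using j z by auto
    then show "z \<in> \<pi> ` {j\<in>{i<..n}. P (\<pi> j)}" using j by blast
  next
    fix z assume "z \<in> \<pi> ` {j\<in>{i<..n}. P (\<pi> j)}"
    then obtain j where j: "j \<in> {i<..n}" "P z" "z = \<pi> j" by auto
    then have "z \<in> {1..n}" using permutes_in_image[OF \<pi>, of j] by auto
    moreover have "z \<notin> \<pi> ` {1..<i}" using j by (auto simp: inj_eq[OF inj])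
    ultimately show "z \<in> {z\<in>{1..n} - \<pi> ` {1..<i}. P z}" using j by simp
  qed
  then show ?thesis using inj by (simp add: card_image inj_on_subset)
qed

lemma stat_a_eq_word_weight:
  assumes \<pi>: "\<pi> permutes {1..n}"
  shows "stat_a (p + 2) n \<pi> = word_weight (descent_weight p {1..n}) {} (map \<pi> [1..<Suc n])"
proof -
  have "stat_a (p + 2) n \<pi>
      = (\<Sum>i\<in>{1..n}. card {j\<in>{i<..n}. \<pi> j < \<pi> i \<and> p \<le> card {l\<in>{1..<i}. \<pi> l < \<pi> j}})"
    unfolding stat_a_def final_pairs_patterns_A[OF \<pi>] by (subst card_SigmaI) auto
  also have "\<dots> = (\<Sum>i\<in>{1..n}. descent_weight p {1..n} (\<pi> ` {1..<i}) (\<pi> i))"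
    unfolding descent_weight_def dominant_image[OF permutes_inj[OF \<pi>]]
    by (intro sum.cong refl, subst card_unused_values[OF \<pi>]) auto
  also have "\<dots> = word_weight (descent_weight p {1..n}) {} (map \<pi> [1..<Suc n])"
    using word_weight_map_upt[of "descent_weight p {1..n}" \<pi> 0 n] by simp
  finally show ?thesis .
qed

lemma stat_b_eq_word_weight:
  assumes \<pi>: "\<pi> permutes {1..n}"
  shows "stat_b (p + 2) n \<pi> = word_weight (ascent_weight p {1..n}) {} (map \<pi> [1..<Suc n])"
proof -
  have "stat_b (p + 2) n \<pi>
      = (\<Sum>i\<in>{1..n}. card {j\<in>{i<..n}. \<pi> i < \<pi> j \<and> p \<le> card {l\<in>{1..<i}. \<pi> l < \<pi> i}})"
    unfolding stat_b_def final_pairs_patterns_B[OF \<pi>] by (subst card_SigmaI) auto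
  also have "\<dots> = (\<Sum>i\<in>{1..n}. ascent_weight p {1..n} (\<pi> ` {1..<i}) (\<pi> i))"
    unfolding ascent_weight_def dominant_image[OF permutes_inj[OF \<pi>]]
    by (intro sum.cong refl, subst card_unused_values[OF \<pi>]) auto
  also have "\<dots> = word_weight (ascent_weight p {1..n}) {} (map \<pi> [1..<Suc n])"
    using word_weight_map_upt[of "ascent_weight p {1..n}" \<pi> 0 n] by simp
  finally show ?thesis .
qed

section \<open>Transfer between permutations and words\<close>

lemma bij_betw_one_line_notation:
  "bij_betw (\<lambda>\<pi>. map \<pi> [1..<Suc n]) {\<pi>. \<pi> permutes {1..n}} (permutations_of_set {1..n})"
    (is "bij_betw ?f ?P ?Q")
proof -
  have inj: "inj_on ?f ?P"
  proof (rule inj_onI)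
    fix \<pi> \<rho> assume "\<pi> \<in> ?P" "\<rho> \<in> ?P" and eq: "?f \<pi> = ?f \<rho>"
    then have perm: "\<pi> permutes {1..n}" "\<rho> permutes {1..n}" by auto
    have "\<pi> x = \<rho> x" if "x \<in> {1..n}" for x
      using eq that by (auto simp del: upt_Suc)
    then show "\<pi> = \<rho>" using perm by (metis ext permutes_not_in)
  qed
  have "?f ` ?P \<subseteq> ?Q"
  proof clarify
    fix \<pi> assume \<pi>: "\<pi> permutes {1..n}"
    have "set [1..<Suc n] = {1..n}" by auto
    then show "?f \<pi> \<in> ?Q"
      using permutes_image[OF \<pi>] permutes_inj_on[OF \<pi>]
      by (auto simp: permutations_of_set_def distinct_map simp del: upt_Suc)
  qed
  \<comment> \<open>Surjectivity follows by counting, since both sets have n! elements.\<close>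
  moreover have "card (?f ` ?P) = card ?Q"
    unfolding card_image[OF inj] using card_permutations[of "{1..n}" n] by simp
  ultimately show ?thesis
    using inj by (simp add: bij_betw_def card_subset_eq del: upt_Suc)
qed

text \<open>Writing the count as a sum of indicators gives it the form
  \<open>f (word_weight ...)\<close> of the equidistribution result.\<close>

lemma card_permutations_word_weight:
  assumes "\<And>\<pi>. \<pi> permutes {1..n} \<Longrightarrow> g \<pi> = word_weight w {} (map \<pi> [1..<Suc n])"
  shows "card {\<pi>. \<pi> permutes {1..n} \<and> g \<pi> = k}
    = (\<Sum>xs\<in>permutations_of_set {1..n}. if word_weight w {} xs = k then 1 else 0)"
proof -
  have fin: "finite {\<pi>. \<pi> permutes {1..n}}" by (simp add: finite_permutations)
  have "card {\<pi>. \<pi> permutes {1..n} \<and> g \<pi> = k}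
      = (\<Sum>\<pi>\<in>{\<pi>. \<pi> permutes {1..n}}. if g \<pi> = k then 1 else 0)"
    using fin by (simp add: sum.If_cases Int_def)
  also have "\<dots> = (\<Sum>\<pi>\<in>{\<pi>. \<pi> permutes {1..n}}.
      if word_weight w {} (map \<pi> [1..<Suc n]) = k then 1 else 0)"
    using assms by (intro sum.cong) auto
  also have "\<dots> = (\<Sum>xs\<in>permutations_of_set {1..n}. if word_weight w {} xs = k then 1 else 0)"
    by (rule sum.reindex_bij_betw[OF bij_betw_one_line_notation])
  finally show ?thesis .
qed

theorem theorem4:
  fixes m n k :: nat
  assumes "m \<ge> 2" and "n \<ge> 1"
  shows "card {\<pi>. \<pi> permutes {1..n} \<and> stat_a m n \<pi> = k}
       = card {\<pi>. \<pi> permutes {1..n} \<and> stat_b m n \<pi> = k}"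
proof -
  obtain p where m: "m = p + 2" using assms(1) by (metis add.commute le_Suc_ex)
  \<comment> \<open>Both words are read from the start, with no value used yet.\<close>
  have "same_state p {} ({} :: nat set)" by (simp add: same_state_def)
  then show ?thesis
    using sum_descent_weight_eq_sum_ascent_weight[of "{1..n}" "{}" "{}" p
        "\<lambda>s. if s = k then 1 else 0"]
      card_permutations_word_weight[OF stat_a_eq_word_weight, of n p k]
      card_permutations_word_weight[OF stat_b_eq_word_weight, of n p k]
    by (simp add: m)
qed

end
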